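(* Let a Lie group $G$ act smoothly on a manifold $\mathcal M$, and let $\mu:G\times\mathcal M\to\mathbb R^\times$ be a multiplier. Suppose that a right moving frame $\rho(\boldsymbol x)\in G$ exists in a neighborhood of $\boldsymbol x\in\mathcal M$. Then: (i) The invariantized multiplier $\mu(\rho(\boldsymbol x),\boldsymbol x)$ is a relative invariant of weight $-1$ with multiplier $\mu$, i.e. $$\mu\bigl(\rho(g\cdot\boldsymbol x),\,g\cdot\boldsymbol x\bigr)=\mu(g,\boldsymbol x)^{-1}\,\mu\bigl(\rho(\boldsymbol x),\boldsymbol x\bigr),\qquad\forall\, g\in G.$$ (ii) The repeated invariantization of the multiplier equals $1$, namely $$\iota\Bigl(\mu\bigl(\rho(\boldsymbol x),\boldsymbol x\bigr)\Bigr)=1.$$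
   Context: $\mathbb R^\times=\mathbb R\setminus\{0\}$. A multiplier is a (smooth) function $\mu:G\times\mathcal M\to\mathbb R^\times$ satisfying $\mu(gh,\boldsymbol x)=\mu(g,h\cdot\boldsymbol x)\,\mu(h,\boldsymbol x)$ and $\mu(e,\boldsymbol x)=1$ for all $g,h\in G$ and $\boldsymbol x\in\mathcal M$. A right moving frame is a smooth map $\rho:\mathcal M\to G$ with $\rho(g\cdot\boldsymbol x)=\rho(\boldsymbol x)g^{-1}$. Moving frames are local objects: when $\rho$ is only defined on an open set, all identities are understood for those $g$ and $\boldsymbol x$ for which both sides are defined. A function $f$ on $\mathcal M$ is a relative invariant of weight $\omega$ with multiplier $\mu$ if $f(g\cdot\boldsymbol x)=\mu(g,\boldsymbol x)^{\omega}f(\boldsymbol x)$ for all $g$ and $\boldsymbol x$. The invariantization of a function $F$ with respect to $\rho$ is the function $\iota(F)(\boldsymbol x)=F(\rho(\boldsymbol x)\cdot\boldsymbol x)$. In (ii), $\iota$ is applied to the function $\boldsymbol x\mapsto\mu(\rho(\boldsymbol x),\boldsymbol x)$. *)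

theory Defs
  imports "HOL-Analysis.Analysis" "HOL-Algebra.Group_Action"
begin

text \<open>
  Smoothness of a map on an open set. For a finite-dimensional domain, continuity of all
  directional derivatives of order at most \<open>k\<close> of a \<open>k\<close> times differentiable map is the same as
  being of class \<open>C\<^sup>k\<close>.
\<close>

primrec Ck_on :: "nat \<Rightarrow> ('a::real_normed_vector \<Rightarrow> 'b::real_normed_vector) \<Rightarrow> 'a set \<Rightarrow> bool" where
  "Ck_on 0 f S \<longleftrightarrow> continuous_on S f"
| "Ck_on (Suc k) f S \<longleftrightarrow>
     (\<forall>x\<in>S. f differentiable (at x)) \<and> (\<forall>v. Ck_on k (\<lambda>x. frechet_derivative f (at x) v) S)"

definition smooth_on :: "('a::real_normed_vector \<Rightarrow> 'b::real_normed_vector) \<Rightarrow> 'a set \<Rightarrow> bool" where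
  "smooth_on f S \<longleftrightarrow> (\<forall>k. Ck_on k f S)"

text \<open>
  A chart is a pair \<open>(U, c)\<close> of its domain and the coordinate map; the values of \<open>c\<close> off \<open>U\<close> are
  irrelevant. The model space is a finite-dimensional normed space rather than an instance of
  \<^class>\<open>euclidean_space\<close>, since the latter class excludes dimension 0 (discrete Lie groups).
\<close>

type_synonym ('a, 'e) chart = "'a set \<times> ('a \<Rightarrow> 'e)"

definition is_chart :: "'a topology \<Rightarrow> ('a, 'e::real_normed_vector) chart \<Rightarrow> bool" where
  "is_chart X = (\<lambda>(U, c). openin X U \<and> open (c ` U) \<and>
     homeomorphic_map (subtopology X U) (top_of_set (c ` U)) c)"

definition compatible_charts ::
  "('a, 'e::real_normed_vector) chart \<Rightarrow> ('a, 'e) chart \<Rightarrow> bool" where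
  "compatible_charts = (\<lambda>(U, c) (V, d). smooth_on (d \<circ> inv_into U c) (c ` (U \<inter> V)))"

locale smooth_manifold =
  fixes X :: "'a topology" and \<A> :: "('a, 'e::real_normed_vector) chart set"
  assumes Hausdorff: "Hausdorff_space X"
    and second_countable: "second_countable X"
    and finite_dim_model: "\<exists>B :: 'e set. finite B \<and> span B = UNIV"
    and charts: "\<And>\<kappa>. \<kappa> \<in> \<A> \<Longrightarrow> is_chart X \<kappa>"
    and charts_cover: "(\<Union>\<kappa>\<in>\<A>. fst \<kappa>) = topspace X"
    and compatible: "\<And>\<kappa> \<kappa>'. \<kappa> \<in> \<A> \<Longrightarrow> \<kappa>' \<in> \<A> \<Longrightarrow> compatible_charts \<kappa> \<kappa>'"

text \<open>
  Smoothness of a map between manifolds \<open>(X, \<A>)\<close> and \<open>(Y, \<B>)\<close>, defined on an open subset \<open>W\<close> of the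
  first one. Continuity is required separately: it makes the domains of the coordinate
  representations open.
\<close>

definition smooth_map_on ::
  "'a topology \<Rightarrow> ('a, 'e::real_normed_vector) chart set \<Rightarrow>
   'b topology \<Rightarrow> ('b, 'f::real_normed_vector) chart set \<Rightarrow> 'a set \<Rightarrow> ('a \<Rightarrow> 'b) \<Rightarrow> bool" where
  "smooth_map_on X \<A> Y \<B> W f \<longleftrightarrow>
     continuous_map (subtopology X W) Y f \<and>
     (\<forall>(U, c)\<in>\<A>. \<forall>(V, d)\<in>\<B>.
        smooth_on (d \<circ> f \<circ> inv_into U c) (c ` {x \<in> W \<inter> U. f x \<in> V}))"

abbreviation smooth_map ::
  "'a topology \<Rightarrow> ('a, 'e::real_normed_vector) chart set \<Rightarrow>
   'b topology \<Rightarrow> ('b, 'f::real_normed_vector) chart set \<Rightarrow> ('a \<Rightarrow> 'b) \<Rightarrow> bool" where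
  "smooth_map X \<A> Y \<B> \<equiv> smooth_map_on X \<A> Y \<B> (topspace X)"

text \<open>Atlas of a product manifold; the underlying space carries \<^const>\<open>prod_topology\<close>.\<close>

definition prod_atlas ::
  "('a, 'e) chart set \<Rightarrow> ('b, 'f) chart set \<Rightarrow> ('a \<times> 'b, 'e \<times> 'f) chart set" where
  "prod_atlas \<A> \<B> = {(U \<times> V, map_prod c d) | U c V d. (U, c) \<in> \<A> \<and> (V, d) \<in> \<B>}"

text \<open>\<open>\<real>\<^sup>\<times>\<close> as an open submanifold of the real line.\<close>

definition nonzero_reals :: "real topology" where
  "nonzero_reals = top_of_set (- {0})"

definition nonzero_reals_atlas :: "(real, real) chart set" where
  "nonzero_reals_atlas = {(- {0}, \<lambda>t. t)}"

locale lie_group = group G + smooth_manifold X \<A>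
  for G :: "('g, 'h) monoid_scheme" (structure)
    and X :: "'g topology" and \<A> :: "('g, 'e::real_normed_vector) chart set" +
  assumes topspace_eq: "topspace X = carrier G"
    and smooth_mult:
      "smooth_map (prod_topology X X) (prod_atlas \<A> \<A>) X \<A> (\<lambda>(g, h). g \<otimes> h)"
    and smooth_inv: "smooth_map X \<A> X \<A> (\<lambda>g. inv g)"

locale smooth_lie_group_action =
  lie_group G X \<A> + M: smooth_manifold Y \<B> + group_action G "topspace Y" \<phi>
  for G :: "('g, 'h) monoid_scheme" (structure)
    and X :: "'g topology" and \<A> :: "('g, 'e::real_normed_vector) chart set"
    and Y :: "'m topology" and \<B> :: "('m, 'f::real_normed_vector) chart set"
    and \<phi> :: "'g \<Rightarrow> 'm \<Rightarrow> 'm" +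
  assumes smooth_action:
    "smooth_map (prod_topology X Y) (prod_atlas \<A> \<B>) Y \<B> (\<lambda>(g, x). \<phi> g x)"

definition multiplier ::
  "('g, 'h) monoid_scheme \<Rightarrow> 'g topology \<Rightarrow> ('g, 'e::real_normed_vector) chart set \<Rightarrow>
   'm topology \<Rightarrow> ('m, 'f::real_normed_vector) chart set \<Rightarrow> ('g \<Rightarrow> 'm \<Rightarrow> 'm) \<Rightarrow>
   ('g \<Rightarrow> 'm \<Rightarrow> real) \<Rightarrow> bool" where
  "multiplier G X \<A> Y \<B> \<phi> \<mu> \<longleftrightarrow>
     smooth_map (prod_topology X Y) (prod_atlas \<A> \<B>) nonzero_reals nonzero_reals_atlas
       (\<lambda>(g, x). \<mu> g x) \<and>
     (\<forall>g\<in>carrier G. \<forall>h\<in>carrier G. \<forall>x\<in>topspace Y.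
        \<mu> (g \<otimes>\<^bsub>G\<^esub> h) x = \<mu> g (\<phi> h x) * \<mu> h x) \<and>
     (\<forall>x\<in>topspace Y. \<mu> \<one>\<^bsub>G\<^esub> x = 1)"

text \<open>
  Moving frames and relative invariants on an open set \<open>U\<close>: the identities are required for those
  \<open>g\<close> and \<open>x\<close> for which both sides are defined, i.e. \<open>x \<in> U\<close> and \<open>g \<cdot> x \<in> U\<close>.
\<close>

definition right_moving_frame_on ::
  "('g, 'h) monoid_scheme \<Rightarrow> 'g topology \<Rightarrow> ('g, 'e::real_normed_vector) chart set \<Rightarrow>
   'm topology \<Rightarrow> ('m, 'f::real_normed_vector) chart set \<Rightarrow> ('g \<Rightarrow> 'm \<Rightarrow> 'm) \<Rightarrow>
   'm set \<Rightarrow> ('m \<Rightarrow> 'g) \<Rightarrow> bool" where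
  "right_moving_frame_on G X \<A> Y \<B> \<phi> U \<rho> \<longleftrightarrow>
     openin Y U \<and> smooth_map_on Y \<B> X \<A> U \<rho> \<and>
     (\<forall>g\<in>carrier G. \<forall>x\<in>U. \<phi> g x \<in> U \<longrightarrow> \<rho> (\<phi> g x) = \<rho> x \<otimes>\<^bsub>G\<^esub> inv\<^bsub>G\<^esub> g)"

definition relative_invariant_on ::
  "('g, 'h) monoid_scheme \<Rightarrow> ('g \<Rightarrow> 'm \<Rightarrow> 'm) \<Rightarrow> ('g \<Rightarrow> 'm \<Rightarrow> real) \<Rightarrow> int \<Rightarrow>
   'm set \<Rightarrow> ('m \<Rightarrow> real) \<Rightarrow> bool" where
  "relative_invariant_on G \<phi> \<mu> \<omega> U f \<longleftrightarrow>
     (\<forall>g\<in>carrier G. \<forall>x\<in>U. \<phi> g x \<in> U \<longrightarrow> f (\<phi> g x) = \<mu> g x powi \<omega> * f x)"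

definition invariantization ::
  "('g \<Rightarrow> 'm \<Rightarrow> 'm) \<Rightarrow> ('m \<Rightarrow> 'g) \<Rightarrow> ('m \<Rightarrow> 'b) \<Rightarrow> 'm \<Rightarrow> 'b" where
  "invariantization \<phi> \<rho> F x = F (\<phi> (\<rho> x) x)"

end

theory Submission
  imports Defs
begin

text \<open>
  A right moving frame satisfies \<open>\<rho> (g \<cdot> x) = \<rho> x g\<^sup>-\<^sup>1\<close>, so the cocycle identity, applied to this product
  at the point \<open>g \<cdot> x\<close>, gives
  \<open>\<mu> (\<rho> (g \<cdot> x), g \<cdot> x) = \<mu> (\<rho> x, g\<^sup>-\<^sup>1 \<cdot> (g \<cdot> x)) \<mu> (g\<^sup>-\<^sup>1, g \<cdot> x) = \<mu> (\<rho> x, x) \<mu> (g, x)\<^sup>-\<^sup>1\<close>;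
  the value of \<open>\<mu>\<close> at \<open>g\<^sup>-\<^sup>1\<close> is the cocycle identity for \<open>g\<^sup>-\<^sup>1 g = e\<close>. This is (i).
  For (ii), equivariance with \<open>g = \<rho> x\<close> shows that the frame takes the value \<open>e\<close> at the normalized point
  \<open>\<rho> x \<cdot> x\<close>, and \<open>\<mu> (e, \<cdot>) = 1\<close>.
\<close>

lemma multiplier_mult:
  assumes "multiplier G X \<A> Y \<B> \<phi> \<mu>"
    and "g \<in> carrier G" "h \<in> carrier G" "x \<in> topspace Y"
  shows "\<mu> (g \<otimes>\<^bsub>G\<^esub> h) x = \<mu> g (\<phi> h x) * \<mu> h x"
  using assms unfolding multiplier_def by blast

lemma multiplier_one:
  assumes "multiplier G X \<A> Y \<B> \<phi> \<mu>" and "x \<in> topspace Y"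
  shows "\<mu> \<one>\<^bsub>G\<^esub> x = 1"
  using assms unfolding multiplier_def by blast

lemma multiplier_inv:
  assumes "group G" and \<mu>: "multiplier G X \<A> Y \<B> \<phi> \<mu>"
    and g: "g \<in> carrier G" and x: "x \<in> topspace Y"
  shows "\<mu> (inv\<^bsub>G\<^esub> g) (\<phi> g x) = inverse (\<mu> g x)"
proof -
  interpret group G by fact
  have "\<mu> (inv\<^bsub>G\<^esub> g) (\<phi> g x) * \<mu> g x = \<mu> (inv\<^bsub>G\<^esub> g \<otimes>\<^bsub>G\<^esub> g) x"
    using multiplier_mult[OF \<mu> inv_closed[OF g] g x] by simp
  also have "\<dots> = 1"
    using multiplier_one[OF \<mu> x] g by simp
  finally show ?thesis
    by (metis inverse_unique mult.commute)
qed

lemma right_moving_frame_on_domain: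
  assumes "right_moving_frame_on G X \<A> Y \<B> \<phi> U \<rho>" and "x \<in> U"
  shows "x \<in> topspace Y"
  using assms openin_subset unfolding right_moving_frame_on_def by blast

text \<open>That the values of \<open>\<rho>\<close> are group elements is encoded in its continuity as a map into \<open>X\<close>.\<close>

lemma right_moving_frame_on_range:
  assumes \<rho>: "right_moving_frame_on G X \<A> Y \<B> \<phi> U \<rho>" and x: "x \<in> U"
  shows "\<rho> x \<in> topspace X"
proof -
  have "continuous_map (subtopology Y U) X \<rho>"
    using \<rho> unfolding right_moving_frame_on_def smooth_map_on_def by blast
  then show ?thesis
    using continuous_map_funspace x right_moving_frame_on_domain[OF \<rho> x] by fastforce
qed

lemma right_moving_frame_on_equivariant:
  assumes "right_moving_frame_on G X \<A> Y \<B> \<phi> U \<rho>"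
    and "g \<in> carrier G" "x \<in> U" "\<phi> g x \<in> U"
  shows "\<rho> (\<phi> g x) = \<rho> x \<otimes>\<^bsub>G\<^esub> inv\<^bsub>G\<^esub> g"
  using assms unfolding right_moving_frame_on_def by blast

lemma invariantized_multiplier_transform:
  assumes "smooth_lie_group_action G X \<A> Y \<B> \<phi>"
    and \<mu>: "multiplier G X \<A> Y \<B> \<phi> \<mu>"
    and \<rho>: "right_moving_frame_on G X \<A> Y \<B> \<phi> U \<rho>"
    and g: "g \<in> carrier G" and x: "x \<in> U" and gx: "\<phi> g x \<in> U"
  shows "\<mu> (\<rho> (\<phi> g x)) (\<phi> g x) = inverse (\<mu> g x) * \<mu> (\<rho> x) x"
proof -
  interpret smooth_lie_group_action G X \<A> Y \<B> \<phi> by fact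
  have xY: "x \<in> topspace Y" and gxY: "\<phi> g x \<in> topspace Y"
    using right_moving_frame_on_domain[OF \<rho>] x gx by blast+
  have \<rho>x: "\<rho> x \<in> carrier G"
    using right_moving_frame_on_range[OF \<rho> x] topspace_eq by simp
  have "\<mu> (\<rho> (\<phi> g x)) (\<phi> g x) = \<mu> (\<rho> x \<otimes>\<^bsub>G\<^esub> inv\<^bsub>G\<^esub> g) (\<phi> g x)"
    by (simp add: right_moving_frame_on_equivariant[OF \<rho> g x gx])
  also have "\<dots> = \<mu> (\<rho> x) (\<phi> (inv\<^bsub>G\<^esub> g) (\<phi> g x)) * \<mu> (inv\<^bsub>G\<^esub> g) (\<phi> g x)"
    by (rule multiplier_mult[OF \<mu> \<rho>x inv_closed[OF g] gxY])
  also have "\<phi> (inv\<^bsub>G\<^esub> g) (\<phi> g x) = x"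
    using orbit_sym_aux[OF g xY refl] .
  also have "\<mu> (inv\<^bsub>G\<^esub> g) (\<phi> g x) = inverse (\<mu> g x)"
    by (rule multiplier_inv[OF group_axioms \<mu> g xY])
  finally show ?thesis
    by (simp add: mult.commute)
qed

text \<open>Equivariance for \<open>g = \<rho> x\<close> gives \<open>\<rho> x (\<rho> x)\<^sup>-\<^sup>1 = e\<close>: at a point that the frame has already normalized,
  nothing is left to be moved.\<close>

lemma right_moving_frame_on_normalized:
  assumes "smooth_lie_group_action G X \<A> Y \<B> \<phi>"
    and \<rho>: "right_moving_frame_on G X \<A> Y \<B> \<phi> U \<rho>"
    and x: "x \<in> U" and \<rho>xx: "\<phi> (\<rho> x) x \<in> U"
  shows "\<rho> (\<phi> (\<rho> x) x) = \<one>\<^bsub>G\<^esub>"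
proof -
  interpret smooth_lie_group_action G X \<A> Y \<B> \<phi> by fact
  have "\<rho> x \<in> carrier G"
    using right_moving_frame_on_range[OF \<rho> x] topspace_eq by simp
  then show ?thesis
    using right_moving_frame_on_equivariant[OF \<rho> _ x \<rho>xx] by simp
qed

theorem theorem5:
  fixes G :: "('g, 'h) monoid_scheme"
    and X :: "'g topology" and \<A> :: "('g, 'e::real_normed_vector) chart set"
    and Y :: "'m topology" and \<B> :: "('m, 'f::real_normed_vector) chart set"
    and \<phi> :: "'g \<Rightarrow> 'm \<Rightarrow> 'm" and \<mu> :: "'g \<Rightarrow> 'm \<Rightarrow> real"
    and \<rho> :: "'m \<Rightarrow> 'g" and U :: "'m set" and x :: 'm
  assumes "smooth_lie_group_action G X \<A> Y \<B> \<phi>"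
    and "multiplier G X \<A> Y \<B> \<phi> \<mu>"
    and "right_moving_frame_on G X \<A> Y \<B> \<phi> U \<rho>"
    and "x \<in> U"
  shows "relative_invariant_on G \<phi> \<mu> (-1) U (\<lambda>y. \<mu> (\<rho> y) y) \<and>
    (\<forall>g\<in>carrier G. \<phi> g x \<in> U \<longrightarrow>
       \<mu> (\<rho> (\<phi> g x)) (\<phi> g x) = inverse (\<mu> g x) * \<mu> (\<rho> x) x) \<and>
    (\<phi> (\<rho> x) x \<in> U \<longrightarrow> invariantization \<phi> \<rho> (\<lambda>y. \<mu> (\<rho> y) y) x = 1)"
proof (intro conjI ballI impI)
  show "relative_invariant_on G \<phi> \<mu> (-1) U (\<lambda>y. \<mu> (\<rho> y) y)"
    unfolding relative_invariant_on_def
    using invariantized_multiplier_transform[OF assms(1-3)] by (simp add: power_int_minus)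
next
  fix g assume "g \<in> carrier G" "\<phi> g x \<in> U"
  then show "\<mu> (\<rho> (\<phi> g x)) (\<phi> g x) = inverse (\<mu> g x) * \<mu> (\<rho> x) x"
    using invariantized_multiplier_transform[OF assms(1-3)] assms(4) by blast
next
  assume U: "\<phi> (\<rho> x) x \<in> U"
  have "\<mu> \<one>\<^bsub>G\<^esub> (\<phi> (\<rho> x) x) = 1"
    using multiplier_one[OF assms(2)] right_moving_frame_on_domain[OF assms(3) U] by blast
  then show "invariantization \<phi> \<rho> (\<lambda>y. \<mu> (\<rho> y) y) x = 1"
    unfolding invariantization_def
    by (simp add: right_moving_frame_on_normalized[OF assms(1,3,4) U])
qed

end
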